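(* For every $\lambda>2$, $$\mathcal{T}_{\mathbb{R}}(\Omega_\lambda)\le\frac{\lambda+2}{2}.$$
   Context: For $\lambda\ge 0$ let $\Omega_\lambda=(-1,1)\cup(\lambda-1,\lambda+1)\cup(-\lambda-1,-\lambda+1)\subset\mathbb{R}$. A function $f:\mathbb{R}\to\mathbb{C}$ is positive definite if $\sum_{j,k=1}^m z_j\overline{z_k}f(x_j-x_k)\ge 0$ for all finite choices of $x_1,\dots,x_m\in\mathbb{R}$ and $z_1,\dots,z_m\in\mathbb{C}$. For an open bounded set $\Omega\subset\mathbb{R}$ with $\Omega=-\Omega$ and $0\in\Omega$, the Turán constant is $$\mathcal{T}_{\mathbb{R}}(\Omega)=\sup\left\{\int_{\mathbb{R}}f(x)\,dx: f\in C(\mathbb{R}),\ f \text{ positive definite},\ f(0)=1,\ \operatorname{supp} f\subset\Omega\right\},$$ where $\operatorname{supp} f$ is the closed support of $f$ (the integrals in question are automatically real). *)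

theory Defs
  imports "HOL-Analysis.Analysis"
begin

definition positive_definite :: "(real \<Rightarrow> complex) \<Rightarrow> bool" where
  "positive_definite f \<longleftrightarrow>
     (\<forall>(m::nat) (x::nat \<Rightarrow> real) (z::nat \<Rightarrow> complex).
        (\<Sum>j<m. \<Sum>k<m. z j * cnj (z k) * f (x j - x k)) \<in> \<real>\<^sub>\<ge>\<^sub>0)"

definition turan_admissible :: "real set \<Rightarrow> (real \<Rightarrow> complex) set" where
  "turan_admissible \<Omega> =
     {f. continuous_on UNIV f \<and> positive_definite f \<and> f 0 = 1 \<and>
         closure (support_on UNIV f) \<subseteq> \<Omega>}"

(* The supremum is taken in ereal, so that an upper bound on the Turan constant includes
   finiteness. The Lebesgue integral of f is real because f (- x) = cnj (f x) for
   positive definite f, so Re only changes its type; for bounded \<Omega> it exists because f is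
   continuous with compact support. *)
definition turan_constant :: "real set \<Rightarrow> ereal" where
  "turan_constant \<Omega> = (SUP f\<in>turan_admissible \<Omega>. ereal (Re (LINT x|lborel. f x)))"

definition Omega_three :: "real \<Rightarrow> real set" where
  "Omega_three l = {-1<..<1} \<union> {l - 1<..<l + 1} \<union> {- l - 1<..<- l + 1}"

lemma Omega_three_open: "open (Omega_three l)"
  unfolding Omega_three_def by (intro open_Un open_greaterThanLessThan)

lemma Omega_three_bounded: "bounded (Omega_three l)"
  unfolding Omega_three_def by (intro bounded_Un[THEN iffD2] conjI) auto

lemma Omega_three_symmetric: "uminus ` Omega_three l = Omega_three l"
  unfolding Omega_three_def by (auto simp: image_Un)

lemma Omega_three_zero: "0 \<in> Omega_three l"
  unfolding Omega_three_def by auto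

end

theory Submission
  imports Defs
begin

text \<open>
  The set \<open>{0, 1} + (l + 2) \<int>\<close> has density \<open>2 / (l + 2)\<close>, and for \<open>l > 2\<close> the differences of
  its distinct points all avoid \<open>Omega_three l\<close>. A positive definite function \<open>f\<close> supported
  in \<open>Omega_three l\<close> therefore vanishes at all these differences, and the integral of such a
  function is at most \<open>f 0\<close> divided by the density.

  To see the last point, put \<open>a = l + 2\<close>, \<open>g = Re f\<close>, and let \<open>P\<close> be the \<open>a\<close>-periodization
  of \<open>g\<close>. It is positive definite on the circle of length \<open>a\<close>
  (\<open>periodization_positive_definite\<close>), and it remains so after its mean \<open>I / a\<close> is subtracted,
  where \<open>I\<close> is the integral of \<open>g\<close>, because the mean is the Fourier coefficient of frequency
  zero. Testing \<open>P - I / a\<close> on the points \<open>0\<close> and \<open>1\<close> with weights \<open>1\<close> gives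
  \<open>0 \<le> 2 * P 0 + P 1 + P (- 1) - 4 * I / a = 2 - 4 * I / a\<close>, so \<open>I \<le> a / 2\<close>.

  Fourier analysis is avoided by working on the grid of \<open>m\<close> equally spaced points of the circle:
  subtracting the mean amounts to the test weights \<open>\<delta>\<^sub>0 + \<delta>\<^sub>s - 2 / m\<close>
  (\<open>grid_inequality\<close>). As \<open>m\<close> grows, with grid points \<open>s * a / m\<close> that approach \<open>1\<close>, the mean
  over the grid, being a Riemann sum, tends to \<open>I / a\<close> (\<open>integral_le_periodization\<close>).
\<close>

section \<open>Real quadratic forms\<close>

definition real_positive_definite :: "(real \<Rightarrow> real) \<Rightarrow> bool" where
  "real_positive_definite g \<longleftrightarrow>
     (\<forall>(m::nat) x z. 0 \<le> (\<Sum>j<m. \<Sum>k<m. z j * z k * g (x j - x k)))"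

lemma positive_definite_imp_Re:
  assumes "positive_definite f"
  shows "real_positive_definite (\<lambda>x. Re (f x))"
  unfolding real_positive_definite_def
proof (intro allI)
  fix m :: nat and x z :: "nat \<Rightarrow> real"
  let ?s = "\<Sum>j<m. \<Sum>k<m. of_real (z j) * cnj (of_real (z k)) * f (x j - x k)"
  have "?s \<in> \<real>\<^sub>\<ge>\<^sub>0"
    using assms unfolding positive_definite_def
    by (elim allE[of _ m] allE[of _ x] allE[of _ "\<lambda>j. of_real (z j)"])
  then have "0 \<le> Re ?s"
    by (simp add: complex_nonneg_Reals_iff)
  also have "Re ?s = (\<Sum>j<m. \<Sum>k<m. z j * z k * Re (f (x j - x k)))"
    by (simp flip: of_real_mult)
  finally show "0 \<le> (\<Sum>j<m. \<Sum>k<m. z j * z k * Re (f (x j - x k)))" .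
qed

lemma real_positive_definiteD:
  fixes p w :: "'i \<Rightarrow> real"
  assumes "real_positive_definite g" and "finite A"
  shows "0 \<le> (\<Sum>i\<in>A. \<Sum>j\<in>A. w i * w j * g (p i - p j))"
proof -
  obtain b where b: "bij_betw b {..<card A} A"
    using ex_bij_betw_nat_finite[OF assms(2)] by (auto simp: atLeast0LessThan)
  have "0 \<le> (\<Sum>i<card A. \<Sum>j<card A. (w \<circ> b) i * (w \<circ> b) j * g ((p \<circ> b) i - (p \<circ> b) j))"
    using assms(1) unfolding real_positive_definite_def by blast
  also have "\<dots> = (\<Sum>i<card A. \<Sum>j\<in>A. w (b i) * w j * g (p (b i) - p j))"
    using sum.reindex_bij_betw[OF b, where g = "\<lambda>j. w (b i) * w j * g (p (b i) - p j)" for i]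
    by simp
  also have "\<dots> = (\<Sum>i\<in>A. \<Sum>j\<in>A. w i * w j * g (p i - p j))"
    using sum.reindex_bij_betw[OF b, where g = "\<lambda>i. \<Sum>j\<in>A. w i * w j * g (p i - p j)"]
    by simp
  finally show ?thesis .
qed

section \<open>Periodization\<close>

text \<open>
  If \<open>g\<close> vanishes outside \<open>{-a<..<a}\<close>, then on \<open>{-a..a}\<close> these three terms are the whole sum of
  \<open>g\<close> over the translates by multiples of \<open>a\<close>.
\<close>
definition periodization :: "real \<Rightarrow> (real \<Rightarrow> real) \<Rightarrow> real \<Rightarrow> real" where
  "periodization a g x = g (x - a) + g x + g (x + a)"

text \<open>
  Grouping the pairs \<open>(k, l)\<close> by \<open>k - l\<close>, only the groups \<open>-1\<close>, \<open>0\<close>, \<open>1\<close> meet the support, and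
  they have \<open>N - 1\<close>, \<open>N\<close>, \<open>N - 1\<close> members. The induction adds one row and one column at a time.
\<close>
lemma sum_translates:
  fixes g :: "real \<Rightarrow> real"
  assumes vanish: "\<And>x. \<bar>x\<bar> \<ge> a \<Longrightarrow> g x = 0" and q: "\<bar>q\<bar> < a" and N: "N \<ge> 1"
  shows "(\<Sum>k<N. \<Sum>l<N. g ((real k - real l) * a + q)) =
    real N * periodization a g q - (g (q - a) + g (q + a))"
  using N
proof (induction N rule: nat_induct_at_least)
  case base
  then show ?case by (simp add: periodization_def)
next
  case (Suc N)
  have a: "a > 0" using q by linarith
  then obtain M where M: "N = Suc M" using Suc.hyps by (cases N) auto
  have far: "g ((real k - real N) * a + q) = 0 \<and> g ((real N - real k) * a + q) = 0"
    if "k < M" for k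
  proof -
    have "2 * a \<le> (real N - real k) * a"
      using that M a by (intro mult_right_mono) auto
    then have "(real k - real N) * a + q \<le> - a" "a \<le> (real N - real k) * a + q"
      using q by (auto simp: algebra_simps abs_less_iff)
    then show ?thesis using vanish by auto
  qed
  have near: "(real M - real N) * a + q = q - a" "(real N - real M) * a + q = q + a"
    using M by (auto simp: algebra_simps)
  have col: "(\<Sum>k<N. g ((real k - real N) * a + q)) = g (q - a)"
    using far near by (simp add: M)
  have row: "(\<Sum>k<N. g ((real N - real k) * a + q)) = g (q + a)"
    using far near by (simp add: M add.commute)
  have "(\<Sum>k<Suc N. \<Sum>l<Suc N. g ((real k - real l) * a + q)) =
      (\<Sum>k<N. \<Sum>l<N. g ((real k - real l) * a + q)) + g (q - a) + g (q + a) + g q"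
    using row col by (simp add: sum.distrib)
  then show ?case using Suc.IH by (simp add: periodization_def algebra_simps)
qed

text \<open>
  Repeat the configuration \<open>p\<close> with the same weights at \<open>N\<close> successive translates by \<open>a\<close>. By
  \<open>sum_translates\<close> the quadratic form of \<open>g\<close> at these points is \<open>N\<close> times the one of the
  periodization, up to a boundary term independent of \<open>N\<close>; dividing by \<open>N\<close> removes it.
\<close>
lemma periodization_positive_definite:
  fixes p w :: "'i \<Rightarrow> real"
  assumes pd: "real_positive_definite g"
    and vanish: "\<And>x. \<bar>x\<bar> \<ge> a \<Longrightarrow> g x = 0"
    and "finite A"
    and p: "\<And>i j. i \<in> A \<Longrightarrow> j \<in> A \<Longrightarrow> \<bar>p i - p j\<bar> < a"
  shows "0 \<le> (\<Sum>i\<in>A. \<Sum>j\<in>A. w i * w j * periodization a g (p i - p j))" (is "0 \<le> ?Q")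
proof -
  define B where "B = (\<Sum>i\<in>A. \<Sum>j\<in>A. w i * w j * (g (p i - p j - a) + g (p i - p j + a)))"
  \<comment> \<open>\<open>B\<close> is the contribution of the missing neighbours of the first and the last translate.\<close>
  have le: "B \<le> real N * ?Q" if "N \<ge> 1" for N
  proof -
    have "0 \<le> (\<Sum>(i, k)\<in>A \<times> {..<N}. \<Sum>(j, l)\<in>A \<times> {..<N}.
        w i * w j * g ((p i + real k * a) - (p j + real l * a)))"
      using real_positive_definiteD[OF pd, of "A \<times> {..<N}" "\<lambda>(i, k). w i"
          "\<lambda>(i, k). p i + real k * a"] \<open>finite A\<close>
      by (simp add: case_prod_unfold)
    also have "\<dots> = (\<Sum>i\<in>A. \<Sum>k<N. \<Sum>j\<in>A. \<Sum>l<N.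
        w i * w j * g ((p i + real k * a) - (p j + real l * a)))"
      by (simp only: sum.cartesian_product[symmetric])
    also have "\<dots> = (\<Sum>i\<in>A. \<Sum>j\<in>A. \<Sum>k<N. \<Sum>l<N.
        w i * w j * g ((p i + real k * a) - (p j + real l * a)))"
      by (intro sum.cong refl sum.swap)
    also have "\<dots> = (\<Sum>i\<in>A. \<Sum>j\<in>A. w i * w j *
        (\<Sum>k<N. \<Sum>l<N. g ((real k - real l) * a + (p i - p j))))"
      by (simp add: sum_distrib_left algebra_simps)
    also have "\<dots> = (\<Sum>i\<in>A. \<Sum>j\<in>A. w i * w j *
        (real N * periodization a g (p i - p j) - (g (p i - p j - a) + g (p i - p j + a))))"
      using sum_translates[where g = g, OF vanish p that]
      by (intro sum.cong refl arg_cong2[where f = "(*)"]) auto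
    also have "\<dots> = real N * ?Q - B"
      unfolding B_def
      by (simp add: sum_distrib_left right_diff_distrib sum_subtractf mult_ac)
    finally show ?thesis by simp
  qed
  show ?thesis
  proof (rule ccontr)
    assume "\<not> 0 \<le> ?Q"
    then have neg: "- ?Q > 0" by simp
    obtain N where "- B < real N * (- ?Q)"
      using reals_Archimedean3[OF neg] by blast
    moreover have "real N * (- ?Q) \<le> real (Suc N) * (- ?Q)"
      using neg by (intro mult_right_mono) auto
    ultimately show False using le[of "Suc N"] by simp
  qed
qed

text \<open>Of the terms on either side, the one farthest from the origin lies outside the support.\<close>
lemma periodization_periodic:
  assumes "\<And>x. \<bar>x\<bar> \<ge> a \<Longrightarrow> g x = 0" and "0 \<le> x" "x \<le> a"
  shows "periodization a g (x - a) = g x + g (x - a)"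
    and "periodization a g x = g x + g (x - a)"
  using assms(1)[of "x - a - a"] assms(1)[of "x + a"] assms(2,3)
  by (auto simp: periodization_def)

section \<open>The test on a cyclic grid\<close>

text \<open>
  A function of period \<open>m * h\<close> has the same sum over every shift of the grid. Periodicity is
  demanded only between \<open>[-m h, 0)\<close> and \<open>[0, m h)\<close>, which is all that
  \<open>periodization_periodic\<close> provides.
\<close>
lemma sum_cyclic_shift:
  fixes P :: "real \<Rightarrow> 'b::comm_monoid_add"
  assumes per: "\<And>n. n < m \<Longrightarrow> P (real n * h - real m * h) = P (real n * h)"
    and "j < m"
  shows "(\<Sum>i<m. P (real i * h - real j * h)) = (\<Sum>i<m. P (real i * h))"
  using \<open>j < m\<close>
proof (induction j)
  case 0
  then show ?case by simp
next
  case (Suc j)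
  obtain M where M: "m = Suc M" using Suc.prems by (cases m) auto
  have "(\<Sum>i<m. P (real i * h - real (Suc j) * h)) =
      P (0 - real (Suc j) * h) + (\<Sum>i<M. P (real i * h - real j * h))"
    unfolding M by (subst sum.lessThan_Suc_shift) (simp add: algebra_simps)
  also have "P (0 - real (Suc j) * h) = P (real M * h - real j * h)"
    using per[of "M - j"] Suc.prems M by (simp add: algebra_simps of_nat_diff)
  also have "\<dots> + (\<Sum>i<M. P (real i * h - real j * h)) = (\<Sum>i<m. P (real i * h - real j * h))"
    unfolding M by (simp add: add.commute)
  finally show ?case using Suc by simp
qed

lemma sum_cyclic_shift':
  fixes P :: "real \<Rightarrow> 'b::comm_monoid_add"
  assumes per: "\<And>n. n < m \<Longrightarrow> P (real n * h - real m * h) = P (real n * h)"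
    and "j < m"
  shows "(\<Sum>i<m. P (real j * h - real i * h)) = (\<Sum>i<m. P (real i * h))"
proof -
  have "(\<Sum>i<m. P (real j * h - real i * h)) =
      (\<Sum>i<m. P (real j * h - real (m - Suc i) * h))"
    by (rule sum.nat_diff_reindex[symmetric])
  also have "\<dots> = (\<Sum>i<m. P (real i * h - real (m - Suc j) * h))"
    using \<open>j < m\<close> by (intro sum.cong refl arg_cong[where f = P]) (auto simp: of_nat_diff algebra_simps)
  also have "\<dots> = (\<Sum>i<m. P (real i * h))"
    using assms by (intro sum_cyclic_shift) auto
  finally show ?thesis .
qed

text \<open>
  The weights \<open>u - c\<close>, with \<open>u\<close> the two unit masses at \<open>0\<close> and \<open>s\<close>, turn the quadratic form
  into that of \<open>u\<close> minus \<open>4 * c * S - m * c\<^sup>2 * S\<close>, where \<open>S\<close> is the sum of \<open>P\<close> over the grid. The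
  choice \<open>c = 2 / m\<close> makes the total weight zero, so that the constant part of \<open>P\<close> is not seen;
  it is also the maximizer of \<open>4 * c - m * c\<^sup>2\<close>.
\<close>
lemma grid_inequality:
  assumes pd: "real_positive_definite g"
    and vanish: "\<And>x. \<bar>x\<bar> \<ge> a \<Longrightarrow> g x = 0"
    and "a > 0" and "s < m"
  defines "h \<equiv> a / real m" and "P \<equiv> periodization a g"
  shows "4 / real m * (\<Sum>i<m. P (real i * h)) \<le> 2 * P 0 + P (real s * h) + P (- (real s * h))"
proof -
  define S where "S = (\<Sum>i<m. P (real i * h))"
  define u :: "nat \<Rightarrow> real" where "u i = of_bool (i = 0) + of_bool (i = s)" for i
  define c where "c = 2 / real m"
  have m: "m > 0" using \<open>s < m\<close> by simp
  have mh: "real m * h = a" using m by (simp add: h_def)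
  have h: "h > 0" using m \<open>a > 0\<close> by (simp add: h_def)
  have per: "P (real n * h - real m * h) = P (real n * h)" if "n < m" for n
  proof -
    have "real n * h \<le> a" using that h unfolding mh[symmetric] by simp
    then show ?thesis
      using periodization_periodic[where g = g and x = "real n * h", OF vanish] h
      unfolding P_def mh by simp
  qed
  have dist: "\<bar>real i * h - real j * h\<bar> < a" if "i < m" "j < m" for i j
  proof -
    have "\<bar>real i - real j\<bar> * h < real m * h"
      using that h by (intro mult_strict_right_mono) auto
    then show ?thesis using h by (simp add: mh abs_mult flip: left_diff_distrib)
  qed
  have sum_u: "(\<Sum>i<m. u i * F i) = F 0 + F s" for F :: "nat \<Rightarrow> real"
    using m \<open>s < m\<close> by (simp add: u_def distrib_right sum.distrib of_bool_def if_distrib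
        [of "\<lambda>x. x * _"] cong: if_cong)
  let ?K = "\<lambda>i j. P (real i * h - real j * h)"
  have row: "(\<Sum>j<m. ?K i j) = S" if "i < m" for i
    unfolding S_def using sum_cyclic_shift'[of m P h i] per that by blast
  have col: "(\<Sum>i<m. ?K i j) = S" if "j < m" for j
    unfolding S_def using sum_cyclic_shift[of m P h j] per that by blast
  have "0 \<le> (\<Sum>i<m. \<Sum>j<m. (u i - c) * (u j - c) * ?K i j)"
    unfolding P_def by (rule periodization_positive_definite[OF pd vanish]) (auto intro: dist)
  also have "\<dots> = (\<Sum>i<m. (u i - c) * ((\<Sum>j<m. u j * ?K i j) - c * (\<Sum>j<m. ?K i j)))"
    by (simp add: sum_distrib_left algebra_simps sum_subtractf sum.distrib)
  also have "\<dots> = (\<Sum>i<m. (u i - c) * (?K i 0 + ?K i s - c * S))"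
    by (intro sum.cong refl) (simp add: sum_u row)
  also have "\<dots> = (\<Sum>i<m. u i * (?K i 0 + ?K i s - c * S)) -
      c * ((\<Sum>i<m. ?K i 0) + (\<Sum>i<m. ?K i s) - real m * (c * S))"
    by (simp add: left_diff_distrib sum_subtractf sum_distrib_left[symmetric] sum.distrib)
  also have "\<dots> = 2 * P 0 + P (real s * h) + P (- (real s * h)) - 4 * c * S + real m * c * c * S"
    using m \<open>s < m\<close> col[of 0] col[of s]
    by (simp only: sum_u col) (simp add: algebra_simps)
  also have "\<dots> = 2 * P 0 + P (real s * h) + P (- (real s * h)) - 4 / real m * S"
    using m by (simp add: c_def)
  finally show ?thesis by (simp add: S_def)
qed

section \<open>Passage to the integral\<close>

text \<open>
  By uniform continuity each cell of length \<open>h\<close> contributes an error of at most \<open>h * e'\<close>; these add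
  up over the first \<open>k\<close> cells by induction on \<open>k\<close>.
\<close>
lemma Riemann_sum_tendsto_integral:
  fixes \<phi> :: "real \<Rightarrow> real"
  assumes cont: "continuous_on {0..a} \<phi>" and "a > 0"
  shows "(\<lambda>m. a / real m * (\<Sum>i<m. \<phi> (real i * (a / real m)))) \<longlonglongrightarrow> integral {0..a} \<phi>"
proof (rule LIMSEQ_I)
  fix e :: real
  assume "e > 0"
  define e' where "e' = e / (2 * a)"
  have "e' > 0" using \<open>e > 0\<close> \<open>a > 0\<close> by (simp add: e'_def)
  moreover have "uniformly_continuous_on {0..a} \<phi>"
    using cont by (intro compact_uniformly_continuous) auto
  ultimately obtain d where "d > 0" and
    d: "\<And>x y. x \<in> {0..a} \<Longrightarrow> y \<in> {0..a} \<Longrightarrow> dist y x < d \<Longrightarrow> dist (\<phi> y) (\<phi> x) < e'"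
    unfolding uniformly_continuous_on_def by metis
  obtain m0 where m0: "real m0 > a / d" using reals_Archimedean2 by blast
  show "\<exists>m0. \<forall>m\<ge>m0. norm (a / real m * (\<Sum>i<m. \<phi> (real i * (a / real m))) - integral {0..a} \<phi>) < e"
  proof (intro exI allI impI)
    fix m assume "m \<ge> m0"
    define h where "h = a / real m"
    have "real m > a / d" using m0 \<open>m \<ge> m0\<close> by linarith
    moreover have "a / d > 0" using \<open>a > 0\<close> \<open>d > 0\<close> by simp
    ultimately have "real m > 0" by linarith
    then have h: "h > 0" "real m * h = a" using \<open>a > 0\<close> by (auto simp: h_def)
    have "h < d" using \<open>real m > a / d\<close> \<open>real m > 0\<close> \<open>d > 0\<close> by (simp add: h_def field_simps)
    have "norm (h * (\<Sum>i<k. \<phi> (real i * h)) - integral {0..real k * h} \<phi>) \<le> real k * h * e'"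
      if "k \<le> m" for k
      using that
    proof (induction k)
      case 0
      then show ?case by simp
    next
      case (Suc k)
      let ?l = "real k * h" and ?r = "real (Suc k) * h"
      have lr: "?r = ?l + h" by (simp add: algebra_simps)
      have "?r \<le> a" unfolding h(2)[symmetric] using h(1) Suc.prems by (intro mult_right_mono) auto
      have sub: "{0..?r} \<subseteq> {0..a}" "{?l..?r} \<subseteq> {0..a}"
        using \<open>?r \<le> a\<close> h(1) by (auto intro: order_trans[of 0 ?l])
      have int: "\<phi> integrable_on {0..?r}" "\<phi> integrable_on {?l..?r}"
        using cont sub by (auto intro!: integrable_continuous_interval intro: continuous_on_subset)
      have split: "integral {0..?r} \<phi> = integral {0..?l} \<phi> + integral {?l..?r} \<phi>"
        using int(1) h(1) by (intro Henstock_Kurzweil_Integration.integral_combine[symmetric]) (auto intro: mult_right_mono)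
      have "((\<lambda>x. \<phi> ?l - \<phi> x) has_integral (h * \<phi> ?l - integral {?l..?r} \<phi>)) {?l..?r}"
        using has_integral_diff[OF has_integral_const_real[of "\<phi> ?l" ?l ?r]
            integrable_integral[OF int(2)]] h(1) lr by simp
      moreover have "norm (\<phi> ?l - \<phi> x) \<le> e'" if "x \<in> {?l..?r}" for x
      proof -
        have "dist ?l x < d" using that \<open>h < d\<close> lr by (auto simp: dist_real_def)
        moreover have "?l \<in> {?l..?r}" using h(1) lr by simp
        ultimately have "dist (\<phi> ?l) (\<phi> x) < e'" using that sub(2) by (intro d) blast+
        then show ?thesis by (simp add: dist_norm)
      qed
      ultimately have "norm (h * \<phi> ?l - integral {?l..?r} \<phi>) \<le> e' * measure lborel {?l..?r}"
        using \<open>e' > 0\<close> by (intro has_integral_bound_real[where S = "{}"]) auto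
      also have "\<dots> = h * e'" using h(1) lr by simp
      finally have "norm (h * \<phi> ?l - integral {?l..?r} \<phi>) \<le> h * e'" .
      then show ?case using Suc split by (simp add: algebra_simps abs_le_iff)
    qed
    from this[of m] have "norm (h * (\<Sum>i<m. \<phi> (real i * h)) - integral {0..a} \<phi>) \<le> a * e'"
      by (simp add: h(2))
    also have "\<dots> < e" using \<open>e > 0\<close> \<open>a > 0\<close> by (simp add: e'_def)
    finally show "norm (a / real m * (\<Sum>i<m. \<phi> (real i * (a / real m))) - integral {0..a} \<phi>) < e"
      unfolding h_def .
  qed
qed

text \<open>
  This is \<open>grid_inequality\<close> in the limit. The point \<open>d\<close> need not be a multiple of the mesh, so it
  is approached by the grid points \<open>s m * a / m\<close>, and continuity of \<open>P\<close> gives the values at \<open>d\<close>.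
  On \<open>{0..a}\<close> the periodization reduces to \<open>g x + g (x - a)\<close>, whose integral is that of \<open>g\<close>
  over both halves of \<open>{-a..a}\<close>.
\<close>
lemma integral_le_periodization:
  assumes pd: "real_positive_definite g"
    and vanish: "\<And>x. \<bar>x\<bar> \<ge> a \<Longrightarrow> g x = 0"
    and cont: "continuous_on UNIV g"
    and "0 \<le> d" "d < a"
  defines "P \<equiv> periodization a g"
  shows "4 / a * integral {-a..a} g \<le> 2 * P 0 + P d + P (- d)"
proof -
  have a: "a > 0" using assms by linarith
  have contP: "isCont P x" for x
  proof -
    have g: "isCont g y" for y using cont by (simp add: continuous_on_eq_continuous_at)
    have "isCont (\<lambda>y. g (y + c)) x" for c by (rule isCont_o2[OF _ g]) simp
    from this[of "- a"] this[of a] show ?thesis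
      unfolding P_def periodization_def using g by simp
  qed
  define \<phi> where "\<phi> x = g x + g (x - a)" for x
  define s where "s m = nat \<lfloor>d / a * real m\<rfloor>" for m
  have s: "(\<lambda>m. real (s m) * (a / real m)) \<longlonglongrightarrow> d"
  proof -
    have nn: "0 \<le> d / a * real m" for m using \<open>0 \<le> d\<close> a by simp
    have "(\<lambda>m. d - real (s m) * (a / real m)) \<longlonglongrightarrow> 0"
    proof (rule tendsto_sandwich[of "\<lambda>_. 0" _ _ "\<lambda>m. a / real m"])
      have "real (s m) * (a / real m) \<le> d \<and> d \<le> (real (s m) + 1) * (a / real m)" if "m > 0" for m
      proof -
        have b: "real (s m) \<le> d / a * real m" "d / a * real m \<le> real (s m) + 1"
          unfolding s_def using nn[of m] by linarith+
        have am: "0 \<le> a / real m" using a by simp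
        show ?thesis
          using mult_right_mono[OF b(1) am] mult_right_mono[OF b(2) am] that a by simp
      qed
      then show "\<forall>\<^sub>F m in sequentially. 0 \<le> d - real (s m) * (a / real m)"
        "\<forall>\<^sub>F m in sequentially. d - real (s m) * (a / real m) \<le> a / real m"
        by (auto intro!: eventually_sequentiallyI[of 1] simp: algebra_simps)
    qed (auto intro!: tendsto_divide_0[OF tendsto_const] filterlim_real_sequentially
         intro: filterlim_at_top_imp_at_infinity)
    then have "(\<lambda>m. d - (d - real (s m) * (a / real m))) \<longlonglongrightarrow> d - 0"
      by (intro tendsto_intros)
    then show ?thesis by simp
  qed
  have "4 / a * (a / real m * (\<Sum>i<m. \<phi> (real i * (a / real m))))
      \<le> 2 * P 0 + P (real (s m) * (a / real m)) + P (- (real (s m) * (a / real m)))"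
    if "m > 0" for m
  proof -
    have "d / a * real m < 1 * real m"
      using \<open>d < a\<close> a that by (intro mult_strict_right_mono) auto
    then have "s m < m" using \<open>0 \<le> d\<close> a that unfolding s_def by (simp add: floor_less_iff nat_less_iff)
    moreover have "\<phi> (real i * (a / real m)) = P (real i * (a / real m))" if "i < m" for i
    proof -
      have "real i * (a / real m) \<le> real m * (a / real m)"
        using a that by (intro mult_right_mono) auto
      then have "real i * (a / real m) \<le> a" using that by simp
      then show ?thesis
        using periodization_periodic(2)[where g = g and x = "real i * (a / real m)", OF vanish] a
        by (simp add: P_def \<phi>_def)
    qed
    ultimately show ?thesis
      using grid_inequality[OF pd vanish a, of "s m" m] a by (simp add: P_def)
  qed
  then have ev: "\<forall>\<^sub>F m in sequentially. 4 / a * (a / real m * (\<Sum>i<m. \<phi> (real i * (a / real m))))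
      \<le> 2 * P 0 + P (real (s m) * (a / real m)) + P (- (real (s m) * (a / real m)))"
    by (intro eventually_sequentiallyI[of 1]) simp
  have "continuous_on {0..a} \<phi>"
    unfolding \<phi>_def using cont
    by (intro continuous_intros continuous_on_compose2[OF cont] continuous_on_subset[OF cont]) auto
  then have lhs: "(\<lambda>m. 4 / a * (a / real m * (\<Sum>i<m. \<phi> (real i * (a / real m)))))
      \<longlonglongrightarrow> 4 / a * integral {0..a} \<phi>"
    using a by (intro tendsto_intros Riemann_sum_tendsto_integral)
  have rhs: "(\<lambda>m. 2 * P 0 + P (real (s m) * (a / real m)) + P (- (real (s m) * (a / real m))))
      \<longlonglongrightarrow> 2 * P 0 + P d + P (- d)"
    by (intro tendsto_intros isCont_tendsto_compose[OF contP] s)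
  have "4 / a * integral {0..a} \<phi> \<le> 2 * P 0 + P d + P (- d)"
    using tendsto_le[OF trivial_limit_sequentially rhs lhs ev] .
  moreover have "integral {0..a} \<phi> = integral {-a..a} g"
  proof -
    have int: "g integrable_on {x..y}" for x y
      by (intro integrable_continuous_interval continuous_on_subset[OF cont]) auto
    have "((\<lambda>x. g (x - a)) has_integral integral {-a..0} g) {0..a}"
      using has_integral_affinity[of g "integral {-a..0} g" "-a" 0 1 "- a"]
        integrable_integral[OF int[of "-a" 0]] a
      by simp
    then have "(\<phi> has_integral (integral {0..a} g + integral {-a..0} g)) {0..a}"
      unfolding \<phi>_def by (intro has_integral_add integrable_integral int)
    moreover have "integral {-a..0} g + integral {0..a} g = integral {-a..a} g"
      using a by (intro Henstock_Kurzweil_Integration.integral_combine int) auto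
    ultimately show ?thesis by (simp add: integral_unique)
  qed
  ultimately show ?thesis by simp
qed

lemma Re_lebesgue_integral_eq_integral:
  fixes f :: "real \<Rightarrow> complex"
  assumes cont: "continuous_on UNIV f" and vanish: "\<And>x. \<bar>x\<bar> \<ge> a \<Longrightarrow> f x = 0"
  shows "Re (LINT x|lborel. f x) = integral {-a..a} (\<lambda>x. Re (f x))"
proof -
  have ind: "(\<lambda>x. indicator {-a..a} x *\<^sub>R f x) = f"
    using vanish by (auto simp: indicator_def fun_eq_iff)
  have "set_integrable lborel {-a..a} f"
    by (intro borel_integrable_atLeastAtMost' continuous_on_subset[OF cont]) auto
  then have si: "set_integrable lborel {-a..a} (\<lambda>x. Re (f x))" and int: "integrable lborel f"
    unfolding set_integrable_def ind
    using integrable_Re[of lborel "\<lambda>x. indicator {-a..a} x *\<^sub>R f x"] by (auto simp: ind)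
  have "Re (LINT x|lborel. f x) = (LINT x|lborel. Re (f x))"
    using int by simp
  also have "\<dots> = (LINT x:{-a..a}|lborel. Re (f x))"
    unfolding set_lebesgue_integral_def
    using arg_cong[OF fun_cong[OF ind], of Re]
    by (intro Bochner_Integration.integral_cong refl) simp
  also have "\<dots> = integral {-a..a} (\<lambda>x. Re (f x))"
    using si by (rule set_borel_integral_eq_integral)
  finally show ?thesis .
qed

theorem lemma5p1:
  fixes l :: real
  assumes "l > 2"
  shows "turan_constant (Omega_three l) \<le> ereal ((l + 2) / 2)"
  unfolding turan_constant_def
proof (rule SUP_least)
  fix f
  assume "f \<in> turan_admissible (Omega_three l)"
  then have cont: "continuous_on UNIV f" and pd: "positive_definite f" and f0: "f 0 = 1"
    and supp: "closure (support_on UNIV f) \<subseteq> Omega_three l"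
    by (auto simp: turan_admissible_def)
  define a where "a = l + 2"
  define g where "g x = Re (f x)" for x
  have f_zero: "f x = 0" if "x \<notin> Omega_three l" for x
    using that supp closure_subset[of "support_on UNIV f"] by (auto simp: support_on_def)
  have vanish: "f x = 0" if "\<bar>x\<bar> \<ge> a" for x
    using that assms by (intro f_zero) (auto simp: Omega_three_def a_def)
  have g: "real_positive_definite g" "continuous_on UNIV g" "\<And>x. \<bar>x\<bar> \<ge> a \<Longrightarrow> g x = 0"
    using positive_definite_imp_Re[OF pd] cont vanish
    by (auto simp: g_def[abs_def] intro!: continuous_intros)
  \<comment> \<open>The points \<open>1\<close>, \<open>1 - a = - l - 1\<close> and \<open>1 + a = l + 3\<close> and their negatives avoid the support;
    for \<open>1\<close> this needs \<open>l > 2\<close>, which puts it in the gap between \<open>1\<close> and \<open>l - 1\<close>.\<close>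
  have P: "periodization a g 0 = 1" "periodization a g 1 = 0" "periodization a g (- 1) = 0"
    using assms f0 by (auto simp: periodization_def g_def f_zero Omega_three_def a_def)
  have "4 / a * integral {-a..a} g \<le> 2"
    using integral_le_periodization[where a = a and d = 1, OF g(1,3,2)] P assms by (simp add: a_def)
  then have "integral {-a..a} g \<le> a / 2"
    using assms by (simp add: a_def field_simps)
  then show "ereal (Re (LINT x|lborel. f x)) \<le> ereal ((l + 2) / 2)"
    using Re_lebesgue_integral_eq_integral[OF cont vanish] by (simp add: g_def[abs_def] a_def)
qed

end
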